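(* In the certification setting described in the context, conditionally on $\mathcal H_j$ (almost surely on $\{n^\star<\infty\}$), $$\Pr\Bigl(\forall g\in\{\mathrm{all},\mathrm{core}\}\text{ enabled},\ \forall m>n^\star\text{ with }N_m^{(g)}>0:\ \ \bar p^{(g)}_{N_m^{(g)}}\ge L_m^{(g)}\ \Bigm|\ \mathcal H_j\Bigr)\ \ge\ 1-\delta_j .$$ The core instance is omitted when core certification is disabled. No independence between the aggregate and core samples is required.
   Context: Timed streams. Let $\mathcal{AP}$ be a finite set of atomic propositions. An infinite timed stream is $\mathbf e=e_0e_1\cdots$ with $e_n=(t_n,\nu_n)$, $t_n\in\mathbb R_{\ge0}$, $\nu_n\subseteq\mathcal{AP}$, $t_n\le t_{n+1}$, $\lim_n t_n=\infty$. $\mathbf e_{\le n}=e_0\cdots e_n$. Here $\mathbf e$ is a random timed stream on a probability space $(\Omega,\mathcal F,\mathbb P)$, and all random objects below are measurable. Formulas. $\Phi$ is generated by $\varphi::=p\mid\top\mid\bot\mid\neg\varphi\mid\varphi\land\varphi\mid\varphi\lor\varphi\mid\Box_{[a,b]}\varphi\mid\Diamond_{[a,b]}\varphi$, $p\in\mathcal{AP}$, $0\le a\le b<\infty$, with satisfaction: $\mathbf e,n\models p$ iff $p\in\nu_n$; $\top$ always, $\bot$ never; Boolean connectives as usual; $\Box_{[a,b]}\varphi$ (resp. $\Diamond_{[a,b]}\varphi$) holds at $n$ iff $\varphi$ holds at all (resp. some) $m\ge n$ with $t_m-t_n\in[a,b]$. Horizon: $0$ for atoms and constants; unchanged by $\neg$;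 maximum for $\land,\lor$; $\operatorname{hzn}(\Box_{[a,b]}\varphi)=\operatorname{hzn}(\Diamond_{[a,b]}\varphi)=b+\operatorname{hzn}(\varphi)$. Specifications. A specification is a tuple $\psi=(\varphi_1^{\mathrm{core}},\varphi_1^{\mathrm{adapt}},\varphi_2^{\mathrm{core}},\varphi_2^{\mathrm{adapt}},\lambda,a,b)$ with formulas in $\Phi$ and $(\lambda,a,b)$ in a fixed measurable envelope $\mathcal A_{\mathrm{par}}\subseteq\{(\lambda,a,b)\in[0,1]\times\mathbb R_{\ge0}^2:a\le b<\infty\}$; $\Psi$ is the (measurable) space of specifications. $\operatorname{trig}(\psi)=\varphi_1^{\mathrm{core}}\lor\varphi_1^{\mathrm{adapt}}$, $\operatorname{resp}(\psi)=\varphi_2^{\mathrm{core}}\land\varphi_2^{\mathrm{adapt}}$, $H(\psi)=\max\{\operatorname{hzn}(\operatorname{trig}(\psi)),b+\operatorname{hzn}(\operatorname{resp}(\psi))\}$, $X_k^\psi=\mathbf 1[\exists m\ge k:t_m-t_k\in[a,b]\land\mathbf e,m\models\operatorname{resp}(\psi)]$. Selection. While version $\psi_j$ is active, at most one candidate is selected. $n^\star\in\mathbb N\cup\{\infty\}$ is the random selection index ($\infty$ if none). On $\{n^\star<\infty\}$: a set $\mathcal P_{n^\star,j}\subseteq\Psi$ of proposed candidates is available, $\psi^\star\in\mathcal P_{n^\star,j}$ is the selected candidate (with the same protected components as $\psi_j$), and $\xi_j$ collects all internal randomness used up to selection; on $\{n^\star=\infty\}$ these, and the stopped prefix, take fixed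 cemetery values. The selection-time information is $\mathcal H_j=\sigma(\mathbf 1_{\{n^\star<\infty\}},n^\star,\mathbf e_{\le n^\star},\mathcal P_{n^\star,j},\psi^\star,\xi_j)$. Everything below is defined on $\{n^\star<\infty\}$. Write $H^\star=H(\psi^\star)$ and $X_k=X_k^{\psi^\star}$, and let $\varphi_1^{\mathrm{core}}$ be the protected trigger of $\psi^\star$. Samples. The aggregate group $g=\mathrm{all}$ is always enabled; the group $g=\mathrm{core}$ is enabled iff $\varphi_1^{\mathrm{core}}\ne\bot$. For $m>n^\star$, $K_m^{(\mathrm{all})}=\{k>n^\star:\mathbf e,k\models\operatorname{trig}(\psi^\star),\ t_m>t_k+H^\star\}$, $K_m^{(\mathrm{core})}=\{k\in K_m^{(\mathrm{all})}:\mathbf e,k\models\varphi_1^{\mathrm{core}}\}$, $N_m^{(g)}=|K_m^{(g)}|$. Standing assumption (recurrence): for every enabled $g$, $\bigcup_{m>n^\star}K_m^{(g)}$ is almost surely infinite; enumerate it increasingly as $k_1^{(g)}<k_2^{(g)}<\cdots$. Let $\tau_s^{(g)}=\min\{m>n^\star:N_m^{(g)}\ge s\}$, $\mathcal G_{j,0}^{(g)}=\mathcal H_j$, $\mathcal G_{j,s}^{(g)}=\sigma(\mathcal H_j,(k_r^{(g)},\tau_r^{(g)},X_{k_r^{(g)}})_{r=1}^s)$. Statistics. $p_s^{(g)}=\Pr(X_{k_s^{(g)}}=1\mid\mathcal G_{j,s-1}^{(g)})$, $\bar p_q^{(g)}=\frac1q\sum_{s=1}^qp_s^{(g)}$, $\widehat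 p_q^{(g)}=\frac1q\sum_{s=1}^qX_{k_s^{(g)}}$. Error levels: $\delta_j\in(0,1)$ and $\delta_j^{\mathrm{all}}>0$, $\delta_j^{\mathrm{core}}\ge0$ are $\mathcal H_j$-measurable with $\delta_j^{\mathrm{all}}+\delta_j^{\mathrm{core}}\le\delta_j$; $\delta_j^{\mathrm{core}}>0$ if core is enabled and $=0$ otherwise. $\delta_{j,q}^{(g)}=6\delta_j^{(g)}/(\pi^2q^2)$. For $q=N_m^{(g)}>0$, $L_m^{(g)}=\max\{0,\ \widehat p_q^{(g)}-\sqrt{\log(1/\delta_{j,q}^{(g)})/(2q)}\}$; $L_m^{(g)}=0$ if $N_m^{(g)}=0$. No stationarity or independence of outcomes is assumed. *)

theory Defs
  imports "HOL-Probability.Probability"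
begin

section \<open>Timed streams and formulas\<close>

type_synonym 'ap event = "real \<times> 'ap set"

definition timed_stream :: "(nat \<Rightarrow> 'ap event) \<Rightarrow> bool" where
  "timed_stream e \<longleftrightarrow>
     (\<forall>n. 0 \<le> fst (e n)) \<and> (\<forall>n. fst (e n) \<le> fst (e (Suc n))) \<and>
     filterlim (\<lambda>n. fst (e n)) at_top sequentially"

datatype 'ap fml =
    Atom 'ap
  | TT
  | FF
  | Neg "'ap fml"
  | And "'ap fml" "'ap fml"
  | Or "'ap fml" "'ap fml"
  | Box real real "'ap fml"
  | Dia real real "'ap fml"

text \<open>The class of formulas \<open>\<Phi>\<close> consists of the terms satisfying \<open>wf_fml\<close>.\<close>

primrec wf_fml :: "'ap fml \<Rightarrow> bool" where
  "wf_fml (Atom p) \<longleftrightarrow> True"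
| "wf_fml TT \<longleftrightarrow> True"
| "wf_fml FF \<longleftrightarrow> True"
| "wf_fml (Neg f) \<longleftrightarrow> wf_fml f"
| "wf_fml (And f g) \<longleftrightarrow> wf_fml f \<and> wf_fml g"
| "wf_fml (Or f g) \<longleftrightarrow> wf_fml f \<and> wf_fml g"
| "wf_fml (Box a b f) \<longleftrightarrow> 0 \<le> a \<and> a \<le> b \<and> wf_fml f"
| "wf_fml (Dia a b f) \<longleftrightarrow> 0 \<le> a \<and> a \<le> b \<and> wf_fml f"

primrec sat :: "(nat \<Rightarrow> 'ap event) \<Rightarrow> nat \<Rightarrow> 'ap fml \<Rightarrow> bool" where
  "sat e n (Atom p) \<longleftrightarrow> p \<in> snd (e n)"
| "sat e n TT \<longleftrightarrow> True"
| "sat e n FF \<longleftrightarrow> False"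
| "sat e n (Neg f) \<longleftrightarrow> \<not> sat e n f"
| "sat e n (And f g) \<longleftrightarrow> sat e n f \<and> sat e n g"
| "sat e n (Or f g) \<longleftrightarrow> sat e n f \<or> sat e n g"
| "sat e n (Box a b f) \<longleftrightarrow> (\<forall>m\<ge>n. fst (e m) - fst (e n) \<in> {a..b} \<longrightarrow> sat e m f)"
| "sat e n (Dia a b f) \<longleftrightarrow> (\<exists>m\<ge>n. fst (e m) - fst (e n) \<in> {a..b} \<and> sat e m f)"

primrec hzn :: "'ap fml \<Rightarrow> real" where
  "hzn (Atom p) = 0"
| "hzn TT = 0"
| "hzn FF = 0"
| "hzn (Neg f) = hzn f"
| "hzn (And f g) = max (hzn f) (hzn g)"
| "hzn (Or f g) = max (hzn f) (hzn g)"
| "hzn (Box a b f) = b + hzn f"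
| "hzn (Dia a b f) = b + hzn f"


section \<open>Specifications\<close>

datatype 'ap spec =
  Spec (core1: "'ap fml") (adapt1: "'ap fml") (core2: "'ap fml") (adapt2: "'ap fml")
       (lam: real) (lo: real) (hi: real)

definition specs :: "(real \<times> real \<times> real) set \<Rightarrow> 'ap spec set" where
  "specs Apar = {\<psi>. wf_fml (core1 \<psi>) \<and> wf_fml (adapt1 \<psi>) \<and> wf_fml (core2 \<psi>) \<and> wf_fml (adapt2 \<psi>)
                    \<and> (lam \<psi>, lo \<psi>, hi \<psi>) \<in> Apar}"

definition trig :: "'ap spec \<Rightarrow> 'ap fml" where
  "trig \<psi> = Or (core1 \<psi>) (adapt1 \<psi>)"

definition resp :: "'ap spec \<Rightarrow> 'ap fml" where
  "resp \<psi> = And (core2 \<psi>) (adapt2 \<psi>)"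

definition spec_hzn :: "'ap spec \<Rightarrow> real" where
  "spec_hzn \<psi> = max (hzn (trig \<psi>)) (hi \<psi> + hzn (resp \<psi>))"

definition outcome :: "(nat \<Rightarrow> 'ap event) \<Rightarrow> 'ap spec \<Rightarrow> nat \<Rightarrow> real" where
  "outcome e \<psi> k =
     of_bool (\<exists>m\<ge>k. fst (e m) - fst (e k) \<in> {lo \<psi>..hi \<psi>} \<and> sat e m (resp \<psi>))"


section \<open>Partially defined random objects\<close>

text \<open>An object defined only on part of the sample space is extended by the cemetery value
  \<open>None\<close>; \<open>cemetery N\<close> is \<open>N\<close> with this point adjoined as a measurable atom.\<close>

definition cemetery :: "'b measure \<Rightarrow> 'b option measure" where
  "cemetery N = sigma (insert None (Some ` space N)) (insert {None} {Some ` A | A. A \<in> sets N})"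

definition partial_obj :: "'w set \<Rightarrow> ('w \<Rightarrow> 'b) \<Rightarrow> 'w \<Rightarrow> 'b option" where
  "partial_obj D Z \<omega> = (if \<omega> \<in> D then Some (Z \<omega>) else None)"

text \<open>The finite word \<open>e\<^sub>0 \<dots> e\<^sub>n\<close>, encoded as the sequence that is \<open>None\<close> beyond \<open>n\<close>.\<close>

definition stream_prefix :: "(nat \<Rightarrow> 'ap event) \<Rightarrow> nat \<Rightarrow> nat \<Rightarrow> 'ap event option" where
  "stream_prefix e n = (\<lambda>i. if i \<le> n then Some (e i) else None)"

definition event_algebra :: "'ap event measure" where
  "event_algebra = borel \<Otimes>\<^sub>M count_space UNIV"

definition prefix_algebra :: "(nat \<Rightarrow> 'ap event option) measure" where
  "prefix_algebra = (\<Pi>\<^sub>M i\<in>UNIV. cemetery event_algebra)"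


section \<open>The certification setting\<close>

datatype group = Aggregate | Core

text \<open>Fields describing objects that exist only after a selection
  (\<open>cands\<close>, \<open>psi_star\<close>, \<open>xi\<close>, \<open>delta\<close>, \<open>dlev\<close>) carry arbitrary values where \<open>nstar\<close> is infinite;
  these values affect neither the sigma-algebras below nor the assumptions of the setting.
  The measurable structures on specifications, on sets of candidates and on
  the internal randomness are parameters; accordingly the locale at the end assumes
  measurability of the random objects derived from the selected specification.\<close>

record ('w, 'ap, 'x) setting =
  PM :: "'w measure"
  strm :: "'w \<Rightarrow> nat \<Rightarrow> 'ap event"
  Apar :: "(real \<times> real \<times> real) set"
  spec_alg :: "'ap spec measure"
  cand_alg :: "'ap spec set measure"
  xi_alg :: "'x measure"
  psi_act :: "'w \<Rightarrow> 'ap spec"                \<comment> \<open>active version \<open>\<psi>\<^sub>j\<close>\<close>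
  nstar :: "'w \<Rightarrow> enat"
  cands :: "'w \<Rightarrow> 'ap spec set"
  psi_star :: "'w \<Rightarrow> 'ap spec"
  xi :: "'w \<Rightarrow> 'x"
  delta :: "'w \<Rightarrow> real"
  dlev :: "group \<Rightarrow> 'w \<Rightarrow> real"

definition selected :: "('w, 'ap, 'x) setting \<Rightarrow> 'w set" where
  "selected S = {\<omega> \<in> space (PM S). nstar S \<omega> < \<infinity>}"

text \<open>The selection-time information \<open>\<H>\<^sub>j\<close>: the sigma-algebra generated by a tuple of random
  elements is the pullback of the product sigma-algebra.\<close>

definition sel_info :: "('w, 'ap, 'x) setting \<Rightarrow> 'w measure" where
  "sel_info S =
     vimage_algebra (space (PM S))
       (\<lambda>\<omega>. (nstar S \<omega> < \<infinity>,
             nstar S \<omega>,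
             partial_obj (selected S) (\<lambda>\<omega>. stream_prefix (strm S \<omega>) (the_enat (nstar S \<omega>))) \<omega>,
             partial_obj (selected S) (cands S) \<omega>,
             partial_obj (selected S) (psi_star S) \<omega>,
             partial_obj (selected S) (xi S) \<omega>))
       (count_space UNIV \<Otimes>\<^sub>M count_space UNIV \<Otimes>\<^sub>M cemetery prefix_algebra \<Otimes>\<^sub>M
        cemetery (cand_alg S) \<Otimes>\<^sub>M cemetery (spec_alg S) \<Otimes>\<^sub>M cemetery (xi_alg S))"

definition hstar :: "('w, 'ap, 'x) setting \<Rightarrow> 'w \<Rightarrow> real" where
  "hstar S \<omega> = spec_hzn (psi_star S \<omega>)"

definition Xout :: "('w, 'ap, 'x) setting \<Rightarrow> nat \<Rightarrow> 'w \<Rightarrow> real" where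
  "Xout S k \<omega> = outcome (strm S \<omega>) (psi_star S \<omega>) k"

fun enabled :: "('w, 'ap, 'x) setting \<Rightarrow> group \<Rightarrow> 'w \<Rightarrow> bool" where
  "enabled S Aggregate \<omega> \<longleftrightarrow> True"
| "enabled S Core \<omega> \<longleftrightarrow> core1 (psi_star S \<omega>) \<noteq> FF"

definition Kset :: "('w, 'ap, 'x) setting \<Rightarrow> group \<Rightarrow> nat \<Rightarrow> 'w \<Rightarrow> nat set" where
  "Kset S g m \<omega> =
     {k. nstar S \<omega> < enat k \<and> sat (strm S \<omega>) k (trig (psi_star S \<omega>)) \<and>
         fst (strm S \<omega> m) > fst (strm S \<omega> k) + hstar S \<omega> \<and>
         (g = Core \<longrightarrow> sat (strm S \<omega>) k (core1 (psi_star S \<omega>)))}"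

definition Ncount :: "('w, 'ap, 'x) setting \<Rightarrow> group \<Rightarrow> nat \<Rightarrow> 'w \<Rightarrow> nat" where
  "Ncount S g m \<omega> = card (Kset S g m \<omega>)"

definition eligible :: "('w, 'ap, 'x) setting \<Rightarrow> group \<Rightarrow> 'w \<Rightarrow> nat set" where
  "eligible S g \<omega> = (\<Union>m\<in>{m. nstar S \<omega> < enat m}. Kset S g m \<omega>)"

text \<open>Samples are numbered from \<open>1\<close>, whereas \<open>enumerate\<close> starts at \<open>0\<close>.\<close>

definition ksamp :: "('w, 'ap, 'x) setting \<Rightarrow> group \<Rightarrow> nat \<Rightarrow> 'w \<Rightarrow> nat" where
  "ksamp S g s \<omega> = enumerate (eligible S g \<omega>) (s - 1)"

definition tau :: "('w, 'ap, 'x) setting \<Rightarrow> group \<Rightarrow> nat \<Rightarrow> 'w \<Rightarrow> nat" where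
  "tau S g s \<omega> = (LEAST m. nstar S \<omega> < enat m \<and> s \<le> Ncount S g m \<omega>)"

definition active :: "('w, 'ap, 'x) setting \<Rightarrow> group \<Rightarrow> 'w set" where
  "active S g = {\<omega> \<in> selected S. enabled S g \<omega>}"

text \<open>The sigma-algebra \<open>\<G>\<^sub>j\<^sub>,\<^sub>s\<close> of the group \<open>g\<close>; the samples take the cemetery value
  where there is no selection or \<open>g\<close> is disabled.\<close>

definition Gfilt :: "('w, 'ap, 'x) setting \<Rightarrow> group \<Rightarrow> nat \<Rightarrow> 'w measure" where
  "Gfilt S g s =
     sigma (space (PM S))
       (sets (sel_info S) \<union>
        (\<Union>r\<in>{1..s}. sets (vimage_algebra (space (PM S))
           (partial_obj (active S g) (\<lambda>\<omega>. (ksamp S g r \<omega>, tau S g r \<omega>, Xout S (ksamp S g r \<omega>) \<omega>)))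
           (cemetery (count_space UNIV \<Otimes>\<^sub>M count_space UNIV \<Otimes>\<^sub>M borel)))))"

definition pcond :: "('w, 'ap, 'x) setting \<Rightarrow> group \<Rightarrow> nat \<Rightarrow> 'w \<Rightarrow> real" where
  "pcond S g s = real_cond_exp (PM S) (Gfilt S g (s - 1))
               (indicator {\<omega> \<in> active S g. Xout S (ksamp S g s \<omega>) \<omega> = 1})"

definition pbar :: "('w, 'ap, 'x) setting \<Rightarrow> group \<Rightarrow> nat \<Rightarrow> 'w \<Rightarrow> real" where
  "pbar S g q \<omega> = (\<Sum>s=1..q. pcond S g s \<omega>) / real q"

definition phat :: "('w, 'ap, 'x) setting \<Rightarrow> group \<Rightarrow> nat \<Rightarrow> 'w \<Rightarrow> real" where
  "phat S g q \<omega> = (\<Sum>s=1..q. Xout S (ksamp S g s \<omega>) \<omega>) / real q"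

definition dlevq :: "('w, 'ap, 'x) setting \<Rightarrow> group \<Rightarrow> nat \<Rightarrow> 'w \<Rightarrow> real" where
  "dlevq S g q \<omega> = 6 * dlev S g \<omega> / (pi\<^sup>2 * (real q)\<^sup>2)"

definition Lbound :: "('w, 'ap, 'x) setting \<Rightarrow> group \<Rightarrow> nat \<Rightarrow> 'w \<Rightarrow> real" where
  "Lbound S g m \<omega> =
     (let q = Ncount S g m \<omega> in
      if q = 0 then 0
      else max 0 (phat S g q \<omega> - sqrt (ln (1 / dlevq S g q \<omega>) / (2 * real q))))"

text \<open>Measurability of an object defined only after a selection means measurability on the
  trace of the ambient sigma-algebra on \<open>selected S\<close>.\<close>

locale certification_setting =
  fixes S :: "('w, 'ap::finite, 'x) setting"
  assumes prob: "prob_space (PM S)"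
    and stream: "\<And>\<omega>. \<omega> \<in> space (PM S) \<Longrightarrow> timed_stream (strm S \<omega>)"
    and stream_meas: "\<And>n. (\<lambda>\<omega>. strm S \<omega> n) \<in> PM S \<rightarrow>\<^sub>M event_algebra"
    and Apar_meas: "Apar S \<in> sets borel"
    and Apar_sub: "Apar S \<subseteq> {(l, a, b). 0 \<le> l \<and> l \<le> 1 \<and> 0 \<le> a \<and> a \<le> b}"
    and spec_alg_space: "space (spec_alg S) = specs (Apar S)"
    and cand_alg_space: "space (cand_alg S) \<subseteq> Pow (specs (Apar S))"
    and psi_act_meas: "psi_act S \<in> PM S \<rightarrow>\<^sub>M spec_alg S"
    and nstar_meas: "nstar S \<in> PM S \<rightarrow>\<^sub>M count_space UNIV"
    and cands_meas: "cands S \<in> restrict_space (PM S) (selected S) \<rightarrow>\<^sub>M cand_alg S"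
    and psi_star_meas: "psi_star S \<in> restrict_space (PM S) (selected S) \<rightarrow>\<^sub>M spec_alg S"
    and xi_meas: "xi S \<in> restrict_space (PM S) (selected S) \<rightarrow>\<^sub>M xi_alg S"
    and psi_star_cand: "\<And>\<omega>. \<omega> \<in> selected S \<Longrightarrow> psi_star S \<omega> \<in> cands S \<omega>"
    and protected: "\<And>\<omega>. \<omega> \<in> selected S \<Longrightarrow>
        core1 (psi_star S \<omega>) = core1 (psi_act S \<omega>) \<and> core2 (psi_star S \<omega>) = core2 (psi_act S \<omega>)"
    and hstar_meas: "hstar S \<in> borel_measurable (restrict_space (PM S) (selected S))"
    and trig_meas: "\<And>k. Measurable.pred (restrict_space (PM S) (selected S))
                          (\<lambda>\<omega>. sat (strm S \<omega>) k (trig (psi_star S \<omega>)))"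
    and core_meas: "\<And>k. Measurable.pred (restrict_space (PM S) (selected S))
                          (\<lambda>\<omega>. sat (strm S \<omega>) k (core1 (psi_star S \<omega>)))"
    and X_meas: "\<And>k. Xout S k \<in> borel_measurable (restrict_space (PM S) (selected S))"
    and recurrence: "\<And>g. AE \<omega> in PM S. \<omega> \<in> active S g \<longrightarrow> infinite (eligible S g \<omega>)"
    and delta_meas: "delta S \<in> borel_measurable (restrict_space (sel_info S) (selected S))"
    and dlev_meas: "\<And>g. dlev S g \<in> borel_measurable (restrict_space (sel_info S) (selected S))"
    and delta_range: "\<And>\<omega>. \<omega> \<in> selected S \<Longrightarrow> 0 < delta S \<omega> \<and> delta S \<omega> < 1"
    and dlev_all: "\<And>\<omega>. \<omega> \<in> selected S \<Longrightarrow> 0 < dlev S Aggregate \<omega>"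
    and dlev_core: "\<And>\<omega>. \<omega> \<in> selected S \<Longrightarrow>
        (if enabled S Core \<omega> then 0 < dlev S Core \<omega> else dlev S Core \<omega> = 0)"
    and dlev_sum: "\<And>\<omega>. \<omega> \<in> selected S \<Longrightarrow> dlev S Aggregate \<omega> + dlev S Core \<omega> \<le> delta S \<omega>"

end

theory Submission
  imports Defs
begin

text \<open>Conditionally on the past, each sampled outcome is a Bernoulli variable, so by Hoeffding's lemma
  the exponential of \<open>l\<close> times the summed deviations, compensated by \<open>q * l\<^sup>2 / 8\<close>, is a
  supermartingale for every \<open>l \<ge> 0\<close> known at selection time. Taking \<open>l\<close> adapted to the
  level \<open>6 * \<delta> / (\<pi>\<^sup>2 * q\<^sup>2)\<close> bounds the failure probability at sample size \<open>q\<close> by that level.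
  The levels sum to \<open>\<delta>\<close> over \<open>q\<close>, and a union bound over the sample sizes and the two groups
  replaces any knowledge of the random sample counts and of the dependence between the groups.
  All estimates are integrated over arbitrary events of the selection-time sigma-algebra, which
  avoids conditional expectations of unbounded variables and yields the conditional statement
  at the end.\<close>

section \<open>An Azuma--Hoeffding inequality with random levels\<close>

lemma (in prob_space) sigma_finite_subalgebraI:
  assumes "subalgebra M F"
  shows "sigma_finite_subalgebra M F"
  by (rule finite_measure_subalgebra_is_sigma_finite, unfold_locales) (rule assms)

lemma (in prob_space) real_cond_exp_indicator_bounds:
  assumes "subalgebra M F" "B \<in> sets M"
  shows "AE x in M. 0 \<le> real_cond_exp M F (indicator B) x \<and> real_cond_exp M F (indicator B) x \<le> 1"
proof -
  interpret sigma_finite_subalgebra M F using assms(1) by (rule sigma_finite_subalgebraI)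
  have [measurable]: "B \<in> sets M" by fact
  have "AE x in M. 0 \<le> real_cond_exp M F (indicator B) x"
    by (rule real_cond_exp_pos) auto
  moreover have "AE x in M. real_cond_exp M F (indicator B) x \<le> 1"
    by (rule real_cond_exp_le_c) (auto intro!: integrable_const_bound[of _ 1] simp: indicator_def)
  ultimately show ?thesis by auto
qed

text \<open>Testing on the sets of \<open>F\<close> identifies the real conditional expectation of
  the indicator with \<open>nn_cond_exp\<close> almost everywhere. The latter admits every
  non-negative \<open>F\<close>-measurable weight, infinite integrals included, so no integrability
  has to be tracked below.\<close>

lemma (in prob_space) nn_integral_mult_cond_prob:
  fixes W :: "'a \<Rightarrow> ennreal"
  assumes "subalgebra M F" "B \<in> sets M" "W \<in> borel_measurable F"
  shows "(\<integral>\<^sup>+x. W x * ennreal (real_cond_exp M F (indicator B) x) \<partial>M) = (\<integral>\<^sup>+x. W x * indicator B x \<partial>M)"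
proof -
  interpret sigma_finite_subalgebra M F using assms(1) by (rule sigma_finite_subalgebraI)
  have [measurable]: "B \<in> sets M" "W \<in> borel_measurable F" by fact+
  let ?p = "real_cond_exp M F (indicator B)"
  have "AE x in M. ennreal (?p x) = nn_cond_exp M F (indicator B) x"
  proof (rule nn_cond_exp_charact)
    fix A assume A [measurable]: "A \<in> sets F"
    then have [measurable]: "A \<in> sets M" using assms(1) by (auto simp: subalgebra_def)
    have i1: "integrable M (\<lambda>x. indicator A x * indicator B x :: real)"
      by (rule integrable_const_bound[of _ 1]) (auto simp: indicator_def)
    have i2: "integrable M (\<lambda>x. indicator A x * ?p x)"
      by (rule real_cond_exp_intg_fpos(1)[OF i1]) auto
    have "(\<integral>\<^sup>+x\<in>A. indicator B x \<partial>M) = (\<integral>\<^sup>+x. ennreal (indicator A x * indicator B x) \<partial>M)"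
      by (intro nn_integral_cong) (auto simp: indicator_def)
    also have "\<dots> = ennreal (\<integral>x. indicator A x * indicator B x \<partial>M)"
      by (rule nn_integral_eq_integral[OF i1]) auto
    also have "\<dots> = ennreal (\<integral>x. indicator A x * ?p x \<partial>M)"
      by (subst real_cond_exp_intg_fpos(2)[OF i1]) auto
    also have "\<dots> = (\<integral>\<^sup>+x. ennreal (indicator A x * ?p x) \<partial>M)"
      by (rule nn_integral_eq_integral[OF i2, symmetric])
         (use real_cond_exp_indicator_bounds[OF assms(1,2)] in auto)
    also have "\<dots> = (\<integral>\<^sup>+x\<in>A. ennreal (?p x) \<partial>M)"
      by (intro nn_integral_cong) (auto simp: indicator_def)
    finally show "(\<integral>\<^sup>+x\<in>A. indicator B x \<partial>M) = (\<integral>\<^sup>+x\<in>A. ennreal (?p x) \<partial>M)" .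
  qed auto
  then have "(\<integral>\<^sup>+x. W x * ennreal (?p x) \<partial>M) = (\<integral>\<^sup>+x. W x * nn_cond_exp M F (indicator B) x \<partial>M)"
    by (intro nn_integral_cong_AE) auto
  also have "\<dots> = (\<integral>\<^sup>+x. W x * indicator B x \<partial>M)"
    by (rule nn_cond_exp_intg) auto
  finally show ?thesis .
qed

section \<open>The exponential supermartingale\<close>

text \<open>The left side is the mean of \<open>exp (l * (X - p) - l\<^sup>2 / 8)\<close> for a
  Bernoulli variable \<open>X\<close> with parameter \<open>p\<close>. Written as a single
  exponential, its exponent is the quantity that Hoeffding's lemma shows to be at most 0.\<close>

lemma Bernoulli_mgf_le:
  fixes l p :: real
  assumes "0 \<le> l" "0 \<le> p" "p \<le> 1"
  shows "exp (l * (1 - p) - l\<^sup>2 / 8) * p + exp (- l * p - l\<^sup>2 / 8) * (1 - p) \<le> 1"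
proof -
  have pos: "1 + p * (exp l - 1) > 0"
    using assms by (intro add_pos_nonneg mult_nonneg_nonneg) auto
  have "exp (l * (1 - p) - l\<^sup>2 / 8) = exp (- l * p - l\<^sup>2 / 8) * exp l"
    by (simp add: exp_add[symmetric] algebra_simps)
  then have "exp (l * (1 - p) - l\<^sup>2 / 8) * p + exp (- l * p - l\<^sup>2 / 8) * (1 - p)
      = exp (- l * p - l\<^sup>2 / 8) * (1 + p * (exp l - 1))"
    by (simp add: algebra_simps)
  also have "\<dots> = exp (- l * p + ln (1 + p * (exp l - 1)) - l\<^sup>2 / 8)"
  proof -
    have "exp (ln (1 + p * (exp l - 1))) = 1 + p * (exp l - 1)"
      using pos by simp
    then show ?thesis by (simp only: exp_diff exp_add) simp
  qed
  also have "\<dots> \<le> 1"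
    using Hoeffdings_lemma_aux[OF assms(1,2)] by simp
  finally show ?thesis .
qed

text \<open>One step of the supermartingale, tested against an arbitrary weight \<open>W\<close>
  known in \<open>F\<close>. The weight later absorbs both the earlier factors and the scaling by
  the random level.\<close>

lemma (in prob_space) nn_integral_exp_deviation_le:
  fixes W :: "'a \<Rightarrow> ennreal" and l :: "'a \<Rightarrow> real"
  assumes F: "subalgebra M F" and B [measurable]: "B \<in> sets M"
    and W: "W \<in> borel_measurable F" and l: "l \<in> borel_measurable F" "\<And>x. 0 \<le> l x"
  defines "p \<equiv> real_cond_exp M F (indicator B)"
  shows "(\<integral>\<^sup>+x. W x * ennreal (exp (l x * (indicator B x - p x) - (l x)\<^sup>2 / 8)) \<partial>M) \<le> (\<integral>\<^sup>+x. W x \<partial>M)"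
proof -
  interpret sigma_finite_subalgebra M F using F by (rule sigma_finite_subalgebraI)
  note [measurable] = W l(1)
  have p [measurable]: "p \<in> borel_measurable F" unfolding p_def by measurable
  note M [measurable] = measurable_from_subalg[OF F W] measurable_from_subalg[OF F l(1)]
    measurable_from_subalg[OF F p]
  have p01: "AE x in M. 0 \<le> p x \<and> p x \<le> 1"
    unfolding p_def by (rule real_cond_exp_indicator_bounds[OF F B])
  define C where "C = space M - B"
  have C [measurable]: "C \<in> sets M" by (simp add: C_def)
  have "AE x in M. real_cond_exp M F (indicator C) x = real_cond_exp M F (\<lambda>x. 1 - indicator B x) x"
    by (rule real_cond_exp_cong) (auto simp: C_def indicator_def)
  moreover have "AE x in M. real_cond_exp M F (\<lambda>x. 1 - indicator B x) x = real_cond_exp M F (\<lambda>x. 1) x - p x"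
    unfolding p_def by (rule real_cond_exp_diff) (auto intro!: integrable_const_bound[of _ 1] simp: indicator_def)
  moreover have "AE x in M. real_cond_exp M F (\<lambda>x. 1) x = 1"
    by (rule real_cond_exp_F_meas) auto
  ultimately have pC: "AE x in M. real_cond_exp M F (indicator C) x = 1 - p x"
    by eventually_elim simp
  \<comment> \<open>Values of the exponential on \<open>B\<close> and off \<open>B\<close>. Unlike
    the exponential itself they are \<open>F\<close>-measurable, so \<open>W * c1\<close> and
    \<open>W * c2\<close> are admissible weights and the two indicators may be replaced by
    \<open>p\<close> and \<open>1 - p\<close>.\<close>
  define c1 where "c1 x = ennreal (exp (l x * (1 - p x) - (l x)\<^sup>2 / 8))" for x
  define c2 where "c2 x = ennreal (exp (- l x * p x - (l x)\<^sup>2 / 8))" for x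
  have [measurable]: "c1 \<in> borel_measurable F" "c2 \<in> borel_measurable F"
    unfolding c1_def c2_def by measurable
  have [measurable]: "c1 \<in> borel_measurable M" "c2 \<in> borel_measurable M"
    unfolding c1_def c2_def by measurable
  have "(\<integral>\<^sup>+x. W x * ennreal (exp (l x * (indicator B x - p x) - (l x)\<^sup>2 / 8)) \<partial>M)
      = (\<integral>\<^sup>+x. (W x * c1 x) * indicator B x + (W x * c2 x) * indicator C x \<partial>M)"
    by (intro nn_integral_cong) (auto simp: indicator_def C_def c1_def c2_def)
  also have "\<dots> = (\<integral>\<^sup>+x. (W x * c1 x) * indicator B x \<partial>M) + (\<integral>\<^sup>+x. (W x * c2 x) * indicator C x \<partial>M)"
    by (rule nn_integral_add) auto
  also have "\<dots> = (\<integral>\<^sup>+x. (W x * c1 x) * ennreal (p x) \<partial>M)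
      + (\<integral>\<^sup>+x. (W x * c2 x) * ennreal (real_cond_exp M F (indicator C) x) \<partial>M)"
    unfolding p_def by (subst (1 2) nn_integral_mult_cond_prob[OF F]) auto
  also have "\<dots> = (\<integral>\<^sup>+x. (W x * c1 x) * ennreal (p x) + (W x * c2 x) * ennreal (real_cond_exp M F (indicator C) x) \<partial>M)"
    by (rule nn_integral_add[symmetric]) auto
  also have "\<dots> \<le> (\<integral>\<^sup>+x. W x \<partial>M)"
  proof (rule nn_integral_mono_AE, use p01 pC in eventually_elim)
    case (elim x)
    have "(W x * c1 x) * ennreal (p x) + (W x * c2 x) * ennreal (real_cond_exp M F (indicator C) x)
        = W x * ennreal (exp (l x * (1 - p x) - (l x)\<^sup>2 / 8) * p x + exp (- l x * p x - (l x)\<^sup>2 / 8) * (1 - p x))"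
      using elim by (subst ennreal_plus) (auto simp: c1_def c2_def distrib_left mult.assoc ennreal_mult)
    also have "\<dots> \<le> W x * ennreal 1"
      using elim l(2) by (intro mult_left_mono ennreal_leI Bernoulli_mgf_le) auto
    finally show ?case by simp
  qed
  finally show ?thesis .
qed

text \<open>The induction peels off the last factor: the first \<open>q\<close> factors involve only
  \<open>B i\<close> and \<open>p i\<close> with \<open>i < q\<close>, hence are known in
  \<open>F q\<close> and join the weight of the one-step bound.\<close>

lemma (in prob_space) nn_integral_exp_sum_deviation_le:
  fixes W :: "'a \<Rightarrow> ennreal" and l :: "'a \<Rightarrow> real" and F :: "nat \<Rightarrow> 'a measure"
  assumes F: "\<And>n. subalgebra M (F n)" and mono: "\<And>n. sets (F n) \<subseteq> sets (F (Suc n))"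
    and B: "\<And>n. B n \<in> sets (F (Suc n))"
    and W: "W \<in> borel_measurable (F 0)" and l: "l \<in> borel_measurable (F 0)" "\<And>x. 0 \<le> l x"
  defines "p n \<equiv> real_cond_exp M (F n) (indicator (B n))"
  shows "(\<integral>\<^sup>+x. W x * ennreal (exp (l x * (\<Sum>i<q. indicator (B i) x - p i x) - real q * (l x)\<^sup>2 / 8)) \<partial>M)
    \<le> (\<integral>\<^sup>+x. W x \<partial>M)"
proof (induction q)
  case 0
  then show ?case by simp
next
  case (Suc q)
  have mono': "i \<le> j \<Longrightarrow> sets (F i) \<subseteq> sets (F j)" for i j
    by (rule lift_Suc_mono_le[of "\<lambda>i. sets (F i)"]) (use mono in auto)
  have meas: "f \<in> borel_measurable (F j)" if "f \<in> borel_measurable (F i)" "i \<le> j"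
    for i j and f :: "'a \<Rightarrow> 'c::topological_space"
    using that mono'[of i j] F[of i] F[of j] by (auto simp: measurable_def subalgebra_def)
  have BM: "B i \<in> sets M" for i using B F[of "Suc i"] by (auto simp: subalgebra_def)
  have Bq: "B i \<in> sets (F q)" if "i < q" for i
    using B[of i] mono'[of "Suc i" q] that by auto
  have p [measurable]: "p i \<in> borel_measurable (F q)" if "i \<le> q" for i
    by (rule meas[OF _ that]) (simp add: p_def)
  have [measurable]: "W \<in> borel_measurable (F q)" "l \<in> borel_measurable (F q)"
    using meas W l(1) by auto
  define V where "V x = W x * ennreal (exp (l x * (\<Sum>i<q. indicator (B i) x - p i x) - real q * (l x)\<^sup>2 / 8))" for x
  have V: "V \<in> borel_measurable (F q)"
    unfolding V_def using Bq by measurable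
  have "(\<integral>\<^sup>+x. W x * ennreal (exp (l x * (\<Sum>i<Suc q. indicator (B i) x - p i x) - real (Suc q) * (l x)\<^sup>2 / 8)) \<partial>M)
     = (\<integral>\<^sup>+x. V x * ennreal (exp (l x * (indicator (B q) x - p q x) - (l x)\<^sup>2 / 8)) \<partial>M)"
    unfolding V_def
    by (intro nn_integral_cong)
       (simp add: mult.assoc ennreal_mult[symmetric] exp_add[symmetric] algebra_simps add_divide_distrib)
  also have "\<dots> \<le> (\<integral>\<^sup>+x. V x \<partial>M)"
    unfolding p_def by (rule nn_integral_exp_deviation_le[OF F BM V _ l(2)]) measurable
  also have "\<dots> \<le> (\<integral>\<^sup>+x. W x \<partial>M)" using Suc.IH by (simp add: V_def)
  finally show ?case .
qed

text \<open>The tilting parameter \<open>l = 4 * sqrt (ln (1 / d) / (2 * q))\<close> optimises the exponential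
  bound; it is random, but known at time \<open>0\<close>.\<close>

lemma (in prob_space) Azuma_Hoeffding_random_level:
  fixes d :: "'a \<Rightarrow> real" and F :: "nat \<Rightarrow> 'a measure"
  assumes F: "\<And>n. subalgebra M (F n)" and mono: "\<And>n. sets (F n) \<subseteq> sets (F (Suc n))"
    and B: "\<And>n. B n \<in> sets (F (Suc n))"
    and A: "A \<in> sets (F 0)" and d: "d \<in> borel_measurable (restrict_space (F 0) A)"
    and d01: "\<And>x. x \<in> A \<Longrightarrow> 0 < d x \<and> d x \<le> 1" and q: "0 < q"
  defines "p n \<equiv> real_cond_exp M (F n) (indicator (B n))"
  shows "emeasure M {x \<in> A. (\<Sum>i<q. p i x) / real q
      < (\<Sum>i<q. indicator (B i) x) / real q - sqrt (ln (1 / d x) / (2 * real q))}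
    \<le> (\<integral>\<^sup>+x\<in>A. ennreal (d x) \<partial>M)"
proof -
  \<comment> \<open>Off \<open>A\<close> the level is set to 1: it becomes
    \<open>F 0\<close>-measurable on the whole space, and the radius \<open>e\<close> vanishes
    there.\<close>
  define d' where "d' x = (if x \<in> A then d x else 1)" for x
  have d'F [measurable]: "d' \<in> borel_measurable (F 0)"
    unfolding d'_def using A d F[of 0]
    by (intro measurable_If_restrict_space_iff[THEN iffD2]) auto
  have d'pos: "0 < d' x" "d' x \<le> 1" for x using d01[of x] by (auto simp: d'_def)
  define e where "e x = sqrt (ln (1 / d' x) / (2 * real q))" for x
  have e0: "0 \<le> e x" for x using d'pos[of x] by (simp add: e_def)
  have e2: "2 * real q * (e x)\<^sup>2 = ln (1 / d' x)" for x
    using d'pos[of x] q by (simp add: e_def)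
  have [measurable]: "e \<in> borel_measurable (F 0)" unfolding e_def by measurable
  have A' [measurable]: "A \<in> sets M" using A F[of 0] by (auto simp: subalgebra_def)
  have [measurable]: "A \<in> sets (F 0)" by fact
  \<comment> \<open>Scaling by the level turns Markov's inequality at the random threshold
    \<open>1 / d'\<close> into one at the constant threshold 1.\<close>
  define W where "W x = ennreal (d' x) * indicator A x" for x
  have W [measurable]: "W \<in> borel_measurable (F 0)" unfolding W_def by measurable
  have BM [measurable]: "B i \<in> sets M" for i using B F[of "Suc i"] by (auto simp: subalgebra_def)
  have [measurable]: "p i \<in> borel_measurable M" for i by (simp add: p_def)
  have [measurable]: "d' \<in> borel_measurable M" by (rule measurable_from_subalg[OF F d'F])
  have [measurable]: "e \<in> borel_measurable M" unfolding e_def by measurable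
  let ?G = "{x \<in> A. (\<Sum>i<q. p i x) / real q
      < (\<Sum>i<q. indicator (B i) x) / real q - sqrt (ln (1 / d x) / (2 * real q))}"
  have G: "?G = {x \<in> A. (\<Sum>i<q. p i x) / real q
      < (\<Sum>i<q. indicator (B i) x) / real q - e x}"
    by (auto simp: e_def d'_def)
  have Gm: "?G \<in> sets M" unfolding G by measurable
  have "emeasure M ?G = (\<integral>\<^sup>+x. indicator ?G x \<partial>M)" using Gm by simp
  also have "\<dots> \<le> (\<integral>\<^sup>+x. W x * ennreal (exp ((4 * e x) * (\<Sum>i<q. indicator (B i) x - p i x)
      - real q * (4 * e x)\<^sup>2 / 8)) \<partial>M)"
  proof (rule nn_integral_mono)
    fix x
    show "indicator ?G x \<le> W x * ennreal (exp ((4 * e x) * (\<Sum>i<q. indicator (B i) x - p i x)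
      - real q * (4 * e x)\<^sup>2 / 8))"
    proof (cases "x \<in> ?G")
      case True
      then have x: "x \<in> A" "e x \<le> (\<Sum>i<q. indicator (B i) x - p i x) / real q"
        unfolding G by (auto simp: sum_subtractf diff_divide_distrib)
      have "e x * real q \<le> (\<Sum>i<q. indicator (B i) x - p i x)"
        using x(2) q by (simp add: field_simps)
      then have "(4 * e x) * (e x * real q) \<le> (4 * e x) * (\<Sum>i<q. indicator (B i) x - p i x)"
        using e0[of x] by (intro mult_left_mono) auto
      \<comment> \<open>With tilt \<open>4 * e\<close> the exponent is at least
        \<open>4 * q * e\<^sup>2 - 2 * q * e\<^sup>2 = 2 * q * e\<^sup>2\<close>, which is
        \<open>ln (1 / d')\<close> by the choice of \<open>e\<close>.\<close>
      then have "ln (1 / d' x) \<le> (4 * e x) * (\<Sum>i<q. indicator (B i) x - p i x) - real q * (4 * e x)\<^sup>2 / 8"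
        using e2[of x] by (simp add: power2_eq_square algebra_simps)
      then have "1 / d' x \<le> exp ((4 * e x) * (\<Sum>i<q. indicator (B i) x - p i x) - real q * (4 * e x)\<^sup>2 / 8)"
        using d'pos[of x] by (metis exp_le_cancel_iff exp_ln zero_less_divide_1_iff)
      then have "1 \<le> d' x * exp ((4 * e x) * (\<Sum>i<q. indicator (B i) x - p i x) - real q * (4 * e x)\<^sup>2 / 8)"
        using d'pos[of x] by (simp add: field_simps)
      then show ?thesis
        using x(1) d'pos[of x] by (simp add: W_def ennreal_mult[symmetric] indicator_def del: ennreal_1 flip: ennreal_1)
    qed simp
  qed
  also have "\<dots> \<le> (\<integral>\<^sup>+x. W x \<partial>M)"
    unfolding p_def
    by (rule nn_integral_exp_sum_deviation_le[OF F mono B W]) (use e0 in auto)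
  also have "\<dots> = (\<integral>\<^sup>+x\<in>A. ennreal (d x) \<partial>M)"
    by (intro nn_integral_cong) (auto simp: W_def d'_def indicator_def)
  finally show ?thesis .
qed

section \<open>Union bound over all sample sizes\<close>

text \<open>The Basel series, normalised to total mass 1 and starting at sample size 1.\<close>

lemma inverse_squares_weights_sums: "(\<lambda>n. 6 / (pi\<^sup>2 * (real (Suc n))\<^sup>2)) sums 1"
proof -
  have "(\<lambda>n. 6 / pi\<^sup>2 * (1 / (real n + 1)\<^sup>2)) sums (6 / pi\<^sup>2 * (pi\<^sup>2 / 6))"
    using inverse_squares_sums by (intro sums_mult) (simp add: add_ac)
  then show ?thesis by (simp add: add_ac)
qed

text \<open>A single term is at most the whole sum. This keeps the share of each sample size at most
  1, as the fixed-size inequality demands of its levels.\<close>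

lemma inverse_squares_weight_le_1: "6 / (pi\<^sup>2 * (real (Suc n))\<^sup>2) \<le> 1"
proof -
  have "6 / (pi\<^sup>2 * (real (Suc n))\<^sup>2) \<le> (\<Sum>n. 6 / (pi\<^sup>2 * (real (Suc n))\<^sup>2))"
    using sum_le_suminf[OF sums_summable[OF inverse_squares_weights_sums], of "{n}"] by auto
  then show ?thesis using sums_unique[OF inverse_squares_weights_sums] by simp
qed

lemma sets_Collect_restrict_space:
  assumes "A \<in> sets M" "Measurable.pred (restrict_space M A) P"
  shows "{x \<in> A. P x} \<in> sets M"
proof -
  have "A \<inter> space M = A" using sets.sets_into_space[OF assms(1)] by auto
  then show ?thesis
    using assms by (simp add: pred_def space_restrict_space sets_restrict_space_iff)
qed

lemma subalgebra_restrict_space: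
  assumes "subalgebra M F"
  shows "subalgebra (restrict_space M A) (restrict_space F A)"
  using assms by (simp add: subalgebra_def space_restrict_space sets_restrict_space image_mono)

text \<open>Each size \<open>q\<close> receives the share
  \<open>6 / (pi\<^sup>2 * q\<^sup>2)\<close> of the level. Countable subadditivity treats all sizes
  at once, so the bound stays usable at a data-dependent size.\<close>

lemma (in prob_space) Azuma_Hoeffding_anytime:
  fixes d :: "'a \<Rightarrow> real" and F :: "nat \<Rightarrow> 'a measure"
  assumes F: "\<And>n. subalgebra M (F n)" and mono: "\<And>n. sets (F n) \<subseteq> sets (F (Suc n))"
    and B: "\<And>n. B n \<in> sets (F (Suc n))"
    and A: "A \<in> sets (F 0)" and d: "d \<in> borel_measurable (restrict_space (F 0) A)"
    and d01: "\<And>x. x \<in> A \<Longrightarrow> 0 < d x \<and> d x \<le> 1"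
  defines "p n \<equiv> real_cond_exp M (F n) (indicator (B n))"
  shows "emeasure M {x \<in> A. \<exists>q>0. (\<Sum>i<q. p i x) / real q
      < (\<Sum>i<q. indicator (B i) x) / real q
        - sqrt (ln (1 / (6 * d x / (pi\<^sup>2 * (real q)\<^sup>2))) / (2 * real q))}
    \<le> (\<integral>\<^sup>+x\<in>A. ennreal (d x) \<partial>M)"
proof -
  define w where "w n = 6 / (pi\<^sup>2 * (real (Suc n))\<^sup>2)" for n
  define lev where "lev n x = 6 * d x / (pi\<^sup>2 * (real (Suc n))\<^sup>2)" for n x
  have lev: "lev n x = w n * d x" for n x by (simp add: lev_def w_def)
  have w: "0 < w n" "w n \<le> 1" for n
    using inverse_squares_weight_le_1[of n] by (auto simp: w_def intro!: divide_pos_pos mult_pos_pos)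
  define G where "G n = {x \<in> A. (\<Sum>i<Suc n. p i x) / real (Suc n)
      < (\<Sum>i<Suc n. indicator (B i) x) / real (Suc n)
        - sqrt (ln (1 / lev n x) / (2 * real (Suc n)))}" for n
  \<comment> \<open>Positive sizes are written \<open>Suc n\<close>, which turns the event into a
    union over all \<open>n\<close>, matching the weights.\<close>
  have ex_gr0: "(\<exists>q>0. P q) \<longleftrightarrow> (\<exists>n. P (Suc n))" for P :: "nat \<Rightarrow> bool"
    using gr0_conv_Suc by auto
  have eq: "{x \<in> A. \<exists>q>0. (\<Sum>i<q. p i x) / real q
      < (\<Sum>i<q. indicator (B i) x) / real q
        - sqrt (ln (1 / (6 * d x / (pi\<^sup>2 * (real q)\<^sup>2))) / (2 * real q))} = (\<Union>n. G n)"
    unfolding G_def lev_def ex_gr0 UNION_eq mem_Collect_eq by simp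
  have AM [measurable]: "A \<in> sets M" using A F[of 0] by (auto simp: subalgebra_def)
  have dM: "d \<in> borel_measurable (restrict_space M A)"
    by (rule measurable_from_subalg[OF subalgebra_restrict_space[OF F] d])
  \<comment> \<open>\<open>d\<close> is measurable on \<open>A\<close> only; extending it by 0
    leaves the product with the indicator unchanged.\<close>
  have dA [measurable]: "(\<lambda>x. ennreal (d x) * indicator A x) \<in> borel_measurable M"
  proof -
    have "(\<lambda>x. if x \<in> A then d x else 0) \<in> borel_measurable M"
      using AM dM by (intro measurable_If_restrict_space_iff[THEN iffD2]) auto
    then have "(\<lambda>x. ennreal (if x \<in> A then d x else 0)) \<in> borel_measurable M" by measurable
    then show ?thesis by (rule measurable_cong[THEN iffD1, rotated]) (auto simp: indicator_def)
  qed
  have le: "emeasure M (G n) \<le> ennreal (w n) * (\<integral>\<^sup>+x\<in>A. ennreal (d x) \<partial>M)" for n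
  proof -
    have "emeasure M (G n) \<le> (\<integral>\<^sup>+x\<in>A. ennreal (lev n x) \<partial>M)"
      unfolding G_def p_def
    proof (rule Azuma_Hoeffding_random_level[OF F mono B A])
      show "lev n \<in> borel_measurable (restrict_space (F 0) A)"
        using d unfolding lev_def by measurable
      show "0 < lev n x \<and> lev n x \<le> 1" if "x \<in> A" for x
        using d01[OF that] w[of n] by (auto simp: lev intro: mult_le_one)
    qed auto
    also have "\<dots> = (\<integral>\<^sup>+x. ennreal (w n) * (ennreal (d x) * indicator A x) \<partial>M)"
      using d01 w[of n] by (intro nn_integral_cong) (auto simp: lev ennreal_mult indicator_def less_imp_le)
    also have "\<dots> = ennreal (w n) * (\<integral>\<^sup>+x\<in>A. ennreal (d x) \<partial>M)"
      by (rule nn_integral_cmult) measurable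
    finally show ?thesis .
  qed
  have "G n \<in> sets M" for n
  proof -
    have BM: "B i \<in> sets M" for i using B F[of "Suc i"] by (auto simp: subalgebra_def)
    have [measurable]: "p i \<in> borel_measurable (restrict_space M A)" for i
      by (intro measurable_restrict_space1) (simp add: p_def)
    have [measurable]: "(indicator (B i) :: 'a \<Rightarrow> real) \<in> borel_measurable (restrict_space M A)" for i
      by (intro measurable_restrict_space1 borel_measurable_indicator BM)
    note [measurable] = dM
    show ?thesis
      unfolding G_def lev_def by (rule sets_Collect_restrict_space[OF AM]) measurable
  qed
  then have "emeasure M (\<Union>n. G n) \<le> (\<Sum>n. emeasure M (G n))"
    by (intro emeasure_subadditive_countably) auto
  also have "\<dots> \<le> (\<Sum>n. ennreal (w n) * (\<integral>\<^sup>+x\<in>A. ennreal (d x) \<partial>M))"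
    by (intro suminf_le le summableI)
  also have "\<dots> = (\<Sum>n. ennreal (w n)) * (\<integral>\<^sup>+x\<in>A. ennreal (d x) \<partial>M)"
    by (rule ennreal_suminf_multc)
  also have "(\<Sum>n. ennreal (w n)) = 1"
  proof -
    have "w sums 1" unfolding w_def by (rule inverse_squares_weights_sums)
    then show ?thesis using w(1) by (subst suminf_ennreal_eq[where x=1]) (auto intro: less_imp_le)
  qed
  finally show ?thesis unfolding eq by simp
qed

section \<open>From integrated to conditional bounds\<close>

text \<open>The hypothesis is tested on the set \<open>A\<close> where the claim fails. It bounds
  the measure of \<open>A\<close> by the integral of \<open>?p + c\<close> over \<open>A\<close>,
  where the integrand is almost everywhere below 1; so \<open>A\<close> is a null set.\<close>

lemma (in prob_space) real_cond_exp_indicator_ge: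
  assumes F: "subalgebra M F" and E [measurable]: "E \<in> sets M" and D: "D \<in> sets F"
    and c: "c \<in> borel_measurable (restrict_space F D)" "\<And>x. x \<in> D \<Longrightarrow> 0 \<le> c x"
    and le: "\<And>A. A \<in> sets F \<Longrightarrow> A \<subseteq> D \<Longrightarrow> emeasure M (A - E) \<le> (\<integral>\<^sup>+x\<in>A. ennreal (c x) \<partial>M)"
  shows "AE x in M. x \<in> D \<longrightarrow> 1 - c x \<le> real_cond_exp M F (indicator E) x"
proof -
  let ?p = "real_cond_exp M F (indicator E)"
  define c' where "c' x = (if x \<in> D then c x else 0)" for x
  have c'F [measurable]: "c' \<in> borel_measurable F"
    unfolding c'_def using D c F
    by (intro measurable_If_restrict_space_iff[THEN iffD2]) auto
  have c'0: "0 \<le> c' x" for x using c(2) by (simp add: c'_def)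
  define A where "A = {x \<in> D. ?p x < 1 - c' x}"
  have [measurable]: "D \<in> sets F" by fact
  have AF [measurable]: "A \<in> sets F" unfolding A_def by measurable
  have AM [measurable]: "A \<in> sets M" using AF F by (auto simp: subalgebra_def)
  have [measurable]: "c' \<in> borel_measurable M" by (rule measurable_from_subalg[OF F c'F])
  have p0: "AE x in M. 0 \<le> ?p x"
    using real_cond_exp_indicator_bounds[OF F E] by auto
  let ?f = "\<lambda>x. indicator A x * ennreal (?p x) + indicator A x * ennreal (c' x)"
  have "emeasure M A \<le> emeasure M (A \<inter> E) + emeasure M (A - E)"
    by (subst plus_emeasure) (auto simp: Int_Diff_Un)
  also have "emeasure M (A \<inter> E) = (\<integral>\<^sup>+x. indicator A x * indicator E x \<partial>M)"
    by (subst nn_integral_indicator[symmetric]) (auto intro!: nn_integral_cong simp del: nn_integral_indicator split: split_indicator)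
  also have "\<dots> = (\<integral>\<^sup>+x. indicator A x * ennreal (?p x) \<partial>M)"
    by (subst nn_integral_mult_cond_prob[OF F E]) auto
  also have "emeasure M (A - E) \<le> (\<integral>\<^sup>+x\<in>A. ennreal (c x) \<partial>M)"
    by (rule le[OF AF]) (auto simp: A_def)
  also have "\<dots> = (\<integral>\<^sup>+x. indicator A x * ennreal (c' x) \<partial>M)"
    by (intro nn_integral_cong) (auto simp: indicator_def c'_def A_def)
  also have "(\<integral>\<^sup>+x. indicator A x * ennreal (?p x) \<partial>M) + (\<integral>\<^sup>+x. indicator A x * ennreal (c' x) \<partial>M)
      = (\<integral>\<^sup>+x. ?f x \<partial>M)"
    by (rule nn_integral_add[symmetric]) auto
  finally have int: "emeasure M A \<le> (\<integral>\<^sup>+x. ?f x \<partial>M)" by (simp add: add_left_mono)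
  have f_lt: "AE x in M. x \<in> A \<longrightarrow> ?f x < 1"
    using p0
  proof eventually_elim
    case (elim x)
    show ?case
    proof
      assume "x \<in> A"
      moreover have "ennreal (?p x) + ennreal (c' x) = ennreal (?p x + c' x)"
        using elim c'0[of x] by simp
      moreover have "ennreal (?p x + c' x) < 1"
        using \<open>x \<in> A\<close> by (simp add: A_def ennreal_less_one_iff del: ennreal_plus)
      ultimately show "?f x < 1" by simp
    qed
  qed
  \<comment> \<open>Otherwise \<open>?f\<close>, almost everywhere at most the indicator of
    \<open>A\<close> and of finite integral, would have a strictly smaller integral than that
    indicator, contrary to \<open>int\<close>.\<close>
  have "AE x in M. indicator A x \<le> ?f x"
  proof (rule ccontr)
    assume "\<not> (AE x in M. indicator A x \<le> ?f x)"
    moreover have fle: "AE x in M. ?f x \<le> indicator A x"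
      using f_lt by eventually_elim (auto simp: indicator_def less_imp_le)
    moreover have "(\<integral>\<^sup>+x. ?f x \<partial>M) \<noteq> \<infinity>"
    proof -
      have "(\<integral>\<^sup>+x. ?f x \<partial>M) \<le> emeasure M A"
        using nn_integral_mono_AE[OF fle] by simp
      then show ?thesis using emeasure_finite[of A] by (auto simp: top_unique)
    qed
    ultimately have "(\<integral>\<^sup>+x. ?f x \<partial>M) < (\<integral>\<^sup>+x. indicator A x \<partial>M)"
      by (intro nn_integral_less) auto
    then show False using int by simp
  qed
  with f_lt have "AE x in M. x \<notin> A"
    by eventually_elim (auto simp: indicator_def)
  then show ?thesis by eventually_elim (auto simp: A_def c'_def)
qed

section \<open>Measurability in the certification setting\<close>

lemma space_cemetery: "space (cemetery N) = insert None (Some ` space N)"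
  unfolding cemetery_def by (intro space_measure_of) (use sets.sets_into_space in auto)

lemma sets_cemetery: "sets (cemetery N) = sigma_sets (insert None (Some ` space N)) (insert {None} {Some ` A | A. A \<in> sets N})"
  unfolding cemetery_def by (intro sets_measure_of) (use sets.sets_into_space in auto)

lemma sets_cemetery_Some: "A \<in> sets N \<Longrightarrow> Some ` A \<in> sets (cemetery N)"
  unfolding sets_cemetery by (rule sigma_sets.Basic) auto

lemma measurable_Some_cemetery: "Some \<in> N \<rightarrow>\<^sub>M cemetery N"
  unfolding cemetery_def
proof (rule measurable_measure_of)
  fix y assume "y \<in> insert {None} {Some ` A | A. A \<in> sets N}"
  then consider "y = {None}" | A where "y = Some ` A" "A \<in> sets N" by blast
  then show "Some -` y \<inter> space N \<in> sets N"
  proof cases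
    case 1
    then have "Some -` y \<inter> space N = {}" by auto
    then show ?thesis by simp
  next
    case 2
    then have "Some -` y \<inter> space N = A" using sets.sets_into_space[of A N] by auto
    then show ?thesis using 2 by simp
  qed
qed (use sets.sets_into_space in auto)

lemma measurable_partial_obj:
  assumes D: "D \<in> sets M" and Z: "Z \<in> restrict_space M D \<rightarrow>\<^sub>M N"
  shows "partial_obj D Z \<in> M \<rightarrow>\<^sub>M cemetery N"
proof -
  have "D \<inter> space M = D" using sets.sets_into_space[OF D] by auto
  then have "(\<lambda>\<omega>. if \<omega> \<in> D then Some (Z \<omega>) else None) \<in> M \<rightarrow>\<^sub>M cemetery N"
    using D measurable_compose[OF Z measurable_Some_cemetery]
    by (intro measurable_restrict_space_iff[THEN iffD1]) (auto simp: space_cemetery)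
  then show ?thesis unfolding partial_obj_def .
qed

lemma measurable_stream_prefix:
  assumes e: "\<And>i. (\<lambda>\<omega>. e \<omega> i) \<in> M \<rightarrow>\<^sub>M event_algebra" and n: "n \<in> M \<rightarrow>\<^sub>M count_space UNIV"
  shows "(\<lambda>\<omega>. stream_prefix (e \<omega>) (n \<omega>)) \<in> M \<rightarrow>\<^sub>M prefix_algebra"
  unfolding prefix_algebra_def stream_prefix_def
proof (rule measurable_PiM_single')
  fix i
  have [measurable]: "(\<lambda>\<omega>. Some (e \<omega> i)) \<in> M \<rightarrow>\<^sub>M cemetery event_algebra"
    by (rule measurable_compose[OF e measurable_Some_cemetery])
  have [measurable]: "(\<lambda>\<omega>. None) \<in> M \<rightarrow>\<^sub>M cemetery event_algebra"
    by (rule measurable_const) (simp add: space_cemetery)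
  note n [measurable]
  show "(\<lambda>\<omega>. if i \<le> n \<omega> then Some (e \<omega> i) else None) \<in> M \<rightarrow>\<^sub>M cemetery event_algebra"
    by measurable
next
  show "(\<lambda>\<omega> i. if i \<le> n \<omega> then Some (e \<omega> i) else None)
    \<in> space M \<rightarrow> (\<Pi>\<^sub>E i\<in>UNIV. space (cemetery event_algebra))"
    using measurable_space[OF e] by (auto simp: space_cemetery)
qed

text \<open>Passing to the next element deletes the least one, and the reduced random set again has
  measurable membership; hence the induction runs over all random sets \<open>E\<close>
  together.\<close>

lemma measurable_enumerate:
  fixes E :: "'a \<Rightarrow> nat set"
  assumes "\<And>k. Measurable.pred M (\<lambda>x. k \<in> E x)"
  shows "(\<lambda>x. enumerate (E x) n) \<in> M \<rightarrow>\<^sub>M count_space UNIV"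
  using assms
proof (induction n arbitrary: E)
  case 0
  note 0 [measurable]
  show ?case unfolding enumerate_0 by measurable
next
  case (Suc n)
  note Suc.prems [measurable]
  have "Measurable.pred M (\<lambda>x. k \<in> E x - {LEAST n. n \<in> E x})" for k
    by simp measurable
  then show ?case unfolding enumerate_Suc by (rule Suc.IH)
qed

section \<open>Selection-time information and sampled quantities\<close>

context certification_setting
begin

sublocale PM: prob_space "PM S" by (rule prob)

abbreviation sel_space :: "'w measure" where "sel_space \<equiv> restrict_space (PM S) (selected S)"

lemma sets_selected: "selected S \<in> sets (PM S)"
  using nstar_meas unfolding selected_def by measurable

lemma nstar_meas_sel: "nstar S \<in> sel_space \<rightarrow>\<^sub>M count_space UNIV"
  by (rule measurable_restrict_space1[OF nstar_meas])

lemma time_meas_sel: "(\<lambda>\<omega>. fst (strm S \<omega> n)) \<in> borel_measurable sel_space"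
  using measurable_compose[OF stream_meas[unfolded event_algebra_def] measurable_fst]
  by (rule measurable_restrict_space1)

lemma sel_info_tuple_meas:
  "(\<lambda>\<omega>. (nstar S \<omega> < \<infinity>,
             nstar S \<omega>,
             partial_obj (selected S) (\<lambda>\<omega>. stream_prefix (strm S \<omega>) (the_enat (nstar S \<omega>))) \<omega>,
             partial_obj (selected S) (cands S) \<omega>,
             partial_obj (selected S) (psi_star S) \<omega>,
             partial_obj (selected S) (xi S) \<omega>))
   \<in> PM S \<rightarrow>\<^sub>M count_space UNIV \<Otimes>\<^sub>M count_space UNIV \<Otimes>\<^sub>M cemetery prefix_algebra \<Otimes>\<^sub>M
        cemetery (cand_alg S) \<Otimes>\<^sub>M cemetery (spec_alg S) \<Otimes>\<^sub>M cemetery (xi_alg S)"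
proof (intro measurable_Pair)
  show "(\<lambda>\<omega>. nstar S \<omega> < \<infinity>) \<in> PM S \<rightarrow>\<^sub>M count_space UNIV"
    by (rule measurable_compose[OF nstar_meas]) simp
  show "partial_obj (selected S) (\<lambda>\<omega>. stream_prefix (strm S \<omega>) (the_enat (nstar S \<omega>)))
    \<in> PM S \<rightarrow>\<^sub>M cemetery prefix_algebra"
  proof (rule measurable_partial_obj[OF sets_selected measurable_stream_prefix])
    show "(\<lambda>\<omega>. strm S \<omega> i) \<in> sel_space \<rightarrow>\<^sub>M event_algebra" for i
      by (rule measurable_restrict_space1[OF stream_meas])
    show "(\<lambda>\<omega>. the_enat (nstar S \<omega>)) \<in> sel_space \<rightarrow>\<^sub>M count_space UNIV"
      by (rule measurable_compose[OF nstar_meas_sel]) simp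
  qed
qed (intro nstar_meas measurable_partial_obj sets_selected cands_meas psi_star_meas xi_meas)+

lemma subalgebra_sel_info: "subalgebra (PM S) (sel_info S)"
  unfolding subalgebra_def sel_info_def
  by (intro conjI sets_image_in_sets sel_info_tuple_meas) simp_all

lemma selected_in_sel_info: "selected S \<in> sets (sel_info S)"
proof -
  let ?N = "count_space UNIV \<Otimes>\<^sub>M count_space UNIV \<Otimes>\<^sub>M cemetery prefix_algebra \<Otimes>\<^sub>M
        cemetery (cand_alg S) \<Otimes>\<^sub>M cemetery (spec_alg S) \<Otimes>\<^sub>M cemetery (xi_alg S)"
  \<comment> \<open>The first coordinate of the generating tuple is the truth value of being
    selected.\<close>
  have "Measurable.pred (sel_info S) (\<lambda>\<omega>. nstar S \<omega> < \<infinity>)"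
    using measurable_compose[OF measurable_vimage_algebra1 measurable_fst,
      OF measurable_space[OF sel_info_tuple_meas, THEN Pi_I]]
    unfolding sel_info_def by simp
  then show ?thesis
    using subalgebra_sel_info by (simp add: selected_def pred_def subalgebra_def)
qed

lemma active_Aggregate: "active S Aggregate = selected S"
  by (auto simp: active_def)

text \<open>The sigma-algebra on specifications is arbitrary, so it need not separate \<open>FF\<close> from the
  other core triggers; that the core group is enabled is nevertheless known at selection time,
  because the level of that group is.\<close>

lemma active_Core: "active S Core = {\<omega> \<in> selected S. 0 < dlev S Core \<omega>}"
  using dlev_core by (force simp: active_def split: if_splits)

lemma active_in_sel_info: "active S g \<in> sets (sel_info S)"
proof (cases g)
  case Aggregate
  then show ?thesis by (simp add: active_Aggregate selected_in_sel_info)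
next
  case Core
  note dlev_meas [measurable]
  show ?thesis unfolding Core active_Core
    by (rule sets_Collect_restrict_space[OF selected_in_sel_info]) measurable
qed

lemma sets_sel_info_subset: "sets (sel_info S) \<subseteq> sets (PM S)"
  using subalgebra_sel_info by (simp add: subalgebra_def)

lemma sets_active: "active S g \<in> sets (PM S)"
  using active_in_sel_info sets_sel_info_subset by auto

lemma active_subset: "active S g \<subseteq> selected S"
  by (auto simp: active_def)

lemma Kset_meas: "Measurable.pred sel_space (\<lambda>\<omega>. k \<in> Kset S g m \<omega>)"
proof -
  note [measurable] = trig_meas core_meas hstar_meas time_meas_sel nstar_meas_sel
  show ?thesis unfolding Kset_def mem_Collect_eq by measurable
qed

lemma eligible_meas: "Measurable.pred sel_space (\<lambda>\<omega>. k \<in> eligible S g \<omega>)"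
proof -
  note [measurable] = Kset_meas nstar_meas_sel
  have "(\<lambda>\<omega>. k \<in> eligible S g \<omega>) = (\<lambda>\<omega>. \<exists>m. nstar S \<omega> < enat m \<and> k \<in> Kset S g m \<omega>)"
    by (auto simp: eligible_def)
  then show ?thesis by simp
qed

lemma Ncount_meas: "Ncount S g m \<in> sel_space \<rightarrow>\<^sub>M count_space UNIV"
  unfolding Ncount_def using Kset_meas[of _ g m]
  by (intro measurable_card) (simp add: pred_def)

lemma ksamp_meas: "ksamp S g s \<in> sel_space \<rightarrow>\<^sub>M count_space UNIV"
  unfolding ksamp_def by (intro measurable_enumerate eligible_meas)

lemma tau_meas: "tau S g s \<in> sel_space \<rightarrow>\<^sub>M count_space UNIV"
proof -
  note [measurable] = Ncount_meas nstar_meas_sel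
  show ?thesis unfolding tau_def by measurable
qed

lemma sample_outcome_meas: "(\<lambda>\<omega>. Xout S (ksamp S g s \<omega>) \<omega>) \<in> borel_measurable sel_space"
  by (rule measurable_compose_countable[OF X_meas ksamp_meas])

section \<open>The filtration of the samples\<close>

definition sample_obj :: "group \<Rightarrow> nat \<Rightarrow> 'w \<Rightarrow> (nat \<times> nat \<times> real) option" where
  "sample_obj g r =
     partial_obj (active S g) (\<lambda>\<omega>. (ksamp S g r \<omega>, tau S g r \<omega>, Xout S (ksamp S g r \<omega>) \<omega>))"

lemma sample_obj_meas:
  "sample_obj g r \<in> PM S \<rightarrow>\<^sub>M cemetery (count_space UNIV \<Otimes>\<^sub>M count_space UNIV \<Otimes>\<^sub>M borel)"
  unfolding sample_obj_def
proof (rule measurable_partial_obj[OF sets_active], rule measurable_restrict_mono[OF _ active_subset])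
  show "(\<lambda>\<omega>. (ksamp S g r \<omega>, tau S g r \<omega>, Xout S (ksamp S g r \<omega>) \<omega>))
    \<in> sel_space \<rightarrow>\<^sub>M count_space UNIV \<Otimes>\<^sub>M count_space UNIV \<Otimes>\<^sub>M borel"
    by (intro measurable_Pair ksamp_meas tau_meas sample_outcome_meas)
qed

definition Gfilt_gen :: "group \<Rightarrow> nat \<Rightarrow> 'w set set" where
  "Gfilt_gen g s = sets (sel_info S) \<union>
        (\<Union>r\<in>{1..s}. sets (vimage_algebra (space (PM S)) (sample_obj g r)
           (cemetery (count_space UNIV \<Otimes>\<^sub>M count_space UNIV \<Otimes>\<^sub>M borel))))"

lemma Gfilt_gen_subset: "Gfilt_gen g s \<subseteq> sets (PM S)"
  unfolding Gfilt_gen_def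
  by (intro Un_least UN_least sets_sel_info_subset sets_image_in_sets sample_obj_meas refl)

lemma Gfilt_eq: "Gfilt S g s = sigma (space (PM S)) (Gfilt_gen g s)"
  unfolding Gfilt_def Gfilt_gen_def sample_obj_def ..

lemma space_Gfilt: "space (Gfilt S g s) = space (PM S)"
  unfolding Gfilt_eq using Gfilt_gen_subset sets.space_closed by (intro space_measure_of) blast

lemma sets_Gfilt: "sets (Gfilt S g s) = sigma_sets (space (PM S)) (Gfilt_gen g s)"
  unfolding Gfilt_eq using Gfilt_gen_subset sets.space_closed by (intro sets_measure_of) blast

lemma subalgebra_Gfilt: "subalgebra (PM S) (Gfilt S g s)"
  using Gfilt_gen_subset by (simp add: subalgebra_def space_Gfilt sets_Gfilt sets.sigma_sets_subset)

text \<open>No sample index lies in \<open>{1..0}\<close>. Events and levels known at selection are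
  thereby known at time 0 of the filtration of either group.\<close>

lemma sets_Gfilt_0: "sets (Gfilt S g 0) = sets (sel_info S)"
proof -
  have "space (sel_info S) = space (PM S)" using subalgebra_sel_info by (simp add: subalgebra_def)
  then show ?thesis
    unfolding sets_Gfilt Gfilt_gen_def using sets.sigma_sets_eq[of "sel_info S"] by simp
qed

lemma Gfilt_mono: "sets (Gfilt S g s) \<subseteq> sets (Gfilt S g (Suc s))"
  unfolding sets_Gfilt by (intro sigma_sets_mono') (auto simp: Gfilt_gen_def)

text \<open>Index \<open>i\<close> stands for sample \<open>i + 1\<close>: the event is revealed at
  stage \<open>Suc i\<close> and predicted from stage \<open>i\<close>, the convention of
  \<open>B\<close> in the Azuma--Hoeffding inequalities.\<close>

definition success :: "group \<Rightarrow> nat \<Rightarrow> 'w set" where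
  "success g i = {\<omega> \<in> active S g. Xout S (ksamp S g (Suc i) \<omega>) \<omega> = 1}"

lemma success_in_Gfilt: "success g i \<in> sets (Gfilt S g (Suc i))"
proof -
  \<comment> \<open>Triples whose last coordinate, the outcome, is 1. The cemetery value is
    excluded, so the preimage lies inside \<open>active S g\<close>.\<close>
  let ?T = "UNIV \<times> UNIV \<times> {1} :: (nat \<times> nat \<times> real) set"
  have "?T \<in> sets (count_space UNIV \<Otimes>\<^sub>M count_space UNIV \<Otimes>\<^sub>M borel)"
    by (intro pair_measureI) auto
  then have "sample_obj g (Suc i) -` (Some ` ?T) \<inter> space (PM S) \<in> Gfilt_gen g (Suc i)"
    unfolding Gfilt_gen_def by (intro UnI2 UN_I[of "Suc i"] in_vimage_algebra sets_cemetery_Some) auto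
  moreover have "sample_obj g (Suc i) -` (Some ` ?T) \<inter> space (PM S) = success g i"
    using sets.sets_into_space[OF sets_active[of g]]
    by (auto simp: success_def sample_obj_def partial_obj_def image_iff split: if_splits)
  ultimately show ?thesis unfolding sets_Gfilt by (auto intro: sigma_sets.Basic)
qed

lemma pcond_eq: "pcond S g (Suc i) = real_cond_exp (PM S) (Gfilt S g i) (indicator (success g i))"
  by (simp add: pcond_def success_def)

lemma pbar_eq: "pbar S g q \<omega> = (\<Sum>i<q. real_cond_exp (PM S) (Gfilt S g i) (indicator (success g i)) \<omega>) / real q"
  unfolding pbar_def pcond_eq[symmetric] by (simp add: sum.atLeast1_atMost_eq)

text \<open>Outcomes take only the values 0 and 1, so on \<open>active S g\<close> a sampled outcome
  is the indicator of the event that it equals 1.\<close>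

lemma phat_eq:
  assumes "\<omega> \<in> active S g"
  shows "phat S g q \<omega> = (\<Sum>i<q. indicator (success g i) \<omega>) / real q"
proof -
  have "Xout S (ksamp S g (Suc i) \<omega>) \<omega> = indicator (success g i) \<omega>" for i
    using assms by (auto simp: success_def indicator_def Xout_def outcome_def)
  then show ?thesis unfolding phat_def by (simp add: sum.atLeast1_atMost_eq)
qed

section \<open>Deviation events and certification\<close>

text \<open>Quantifying over all fixed sizes \<open>q\<close> instead of the random counts
  \<open>Ncount\<close> lets one event cover every time \<open>m\<close>.\<close>

definition deviation :: "group \<Rightarrow> 'w set" where
  "deviation g = {\<omega> \<in> selected S. \<exists>q>0. pbar S g q \<omega>
     < phat S g q \<omega> - sqrt (ln (1 / dlevq S g q \<omega>) / (2 * real q))}"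

text \<open>The upper bound comes from the budget: both levels are non-negative and add up to at
  most \<open>delta S\<close>, which is below 1.\<close>

lemma dlev_active:
  assumes "\<omega> \<in> active S g"
  shows "0 < dlev S g \<omega> \<and> dlev S g \<omega> \<le> 1"
proof -
  have \<omega>: "\<omega> \<in> selected S" using assms active_subset by auto
  then have "0 < dlev S Aggregate \<omega>" "0 \<le> dlev S Core \<omega>"
    using dlev_all[OF \<omega>] dlev_core[OF \<omega>] by (auto split: if_splits)
  moreover have "0 < dlev S g \<omega>"
    using assms dlev_all[OF \<omega>] dlev_core[OF \<omega>] by (cases g) (auto simp: active_def)
  ultimately show ?thesis
    using dlev_sum[OF \<omega>] delta_range[OF \<omega>] by (cases g) auto
qed

text \<open>Being active is known at selection, so \<open>A \<inter> active S g\<close> is an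
  admissible time-0 event, and on it the statistics are the averages in the anytime
  inequality.\<close>

lemma emeasure_deviation_le:
  assumes A: "A \<in> sets (sel_info S)"
  shows "emeasure (PM S) (A \<inter> active S g \<inter> deviation g)
    \<le> (\<integral>\<^sup>+\<omega>\<in>A \<inter> active S g. ennreal (dlev S g \<omega>) \<partial>PM S)"
proof -
  let ?A = "A \<inter> active S g"
  have A0: "?A \<in> sets (Gfilt S g 0)"
    unfolding sets_Gfilt_0 by (intro sets.Int A active_in_sel_info)
  have "dlev S g \<in> borel_measurable (restrict_space (sel_info S) ?A)"
    using active_subset by (intro measurable_restrict_mono[OF dlev_meas]) auto
  then have d: "dlev S g \<in> borel_measurable (restrict_space (Gfilt S g 0) ?A)"
    by (simp cong: measurable_cong_sets add: sets_Gfilt_0 sets_restrict_space_cong[OF sets_Gfilt_0])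
  have "?A \<inter> deviation g = {\<omega> \<in> ?A. \<exists>q>0.
      (\<Sum>i<q. real_cond_exp (PM S) (Gfilt S g i) (indicator (success g i)) \<omega>) / real q
      < (\<Sum>i<q. indicator (success g i) \<omega>) / real q
        - sqrt (ln (1 / (6 * dlev S g \<omega> / (pi\<^sup>2 * (real q)\<^sup>2))) / (2 * real q))}"
    unfolding deviation_def using active_subset[of g]
    by (auto simp: pbar_eq phat_eq dlevq_def)
  then show ?thesis
    using PM.Azuma_Hoeffding_anytime[OF subalgebra_Gfilt Gfilt_mono success_in_Gfilt A0 d] dlev_active
    by (simp add: Int_assoc)
qed

lemma dlev_meas_sel: "dlev S g \<in> borel_measurable sel_space"
  by (rule measurable_from_subalg[OF subalgebra_restrict_space[OF subalgebra_sel_info] dlev_meas])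

lemma phat_meas: "phat S g q \<in> borel_measurable sel_space"
  unfolding phat_def by (intro borel_measurable_divide borel_measurable_sum sample_outcome_meas measurable_const) simp_all

lemma pbar_meas: "pbar S g q \<in> borel_measurable sel_space"
  unfolding pbar_def pcond_def by (rule measurable_restrict_space1) simp

lemma radius_meas:
  "(\<lambda>\<omega>. sqrt (ln (1 / dlevq S g q \<omega>) / (2 * real q))) \<in> borel_measurable sel_space"
proof -
  note dlev_meas_sel [measurable]
  show ?thesis unfolding dlevq_def by measurable
qed

definition certified :: "'w set" where
  "certified = {\<omega> \<in> selected S.
                \<forall>g. enabled S g \<omega> \<longrightarrow>
                  (\<forall>m. nstar S \<omega> < enat m \<and> 0 < Ncount S g m \<omega> \<longrightarrow>
                     pbar S g (Ncount S g m \<omega>) \<omega> \<ge> Lbound S g m \<omega>)}"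

lemma Lbound_meas: "Lbound S g m \<in> borel_measurable sel_space"
proof -
  \<comment> \<open>The size is fixed first; the random count takes countably many values, so
    substituting it preserves measurability.\<close>
  have "(\<lambda>\<omega>. if q = 0 then 0 else max 0 (phat S g q \<omega> - sqrt (ln (1 / dlevq S g q \<omega>) / (2 * real q))))
      \<in> borel_measurable sel_space" for q
    by (cases "q = 0") (simp_all add: borel_measurable_max borel_measurable_diff phat_meas radius_meas)
  from measurable_compose_countable[OF this Ncount_meas[of g m]]
  show ?thesis by (simp add: Lbound_def[abs_def] Let_def)
qed

lemma sets_certified: "certified \<in> sets (PM S)"
proof -
  have all_group: "(\<forall>g. P g) \<longleftrightarrow> P Aggregate \<and> P Core" for P
    by (metis group.exhaust)
  note [measurable] = nstar_meas_sel Ncount_meas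
  have "Measurable.pred sel_space (\<lambda>\<omega>. \<omega> \<in> active S g)" for g
    using sets_active[of g] by (intro measurable_restrict_space1) simp
  note [measurable] = this
  have "Measurable.pred sel_space (\<lambda>\<omega>. Lbound S g m \<omega> \<le> pbar S g (Ncount S g m \<omega>) \<omega>)" for g m
    unfolding pred_def
    by (rule borel_measurable_le[OF Lbound_meas measurable_compose_countable[OF pbar_meas Ncount_meas]])
  note [measurable] = this
  \<comment> \<open>Being enabled is replaced by membership in \<open>active S g\<close>, whose
    measurability is already known; the two agree on \<open>selected S\<close>.\<close>
  have "{\<omega> \<in> selected S. \<forall>g. \<omega> \<in> active S g \<longrightarrow>
      (\<forall>m. nstar S \<omega> < enat m \<and> 0 < Ncount S g m \<omega> \<longrightarrow>
         Lbound S g m \<omega> \<le> pbar S g (Ncount S g m \<omega>) \<omega>)} \<in> sets (PM S)"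
    unfolding all_group by (rule sets_Collect_restrict_space[OF sets_selected]) measurable
  also have "{\<omega> \<in> selected S. \<forall>g. \<omega> \<in> active S g \<longrightarrow>
      (\<forall>m. nstar S \<omega> < enat m \<and> 0 < Ncount S g m \<omega> \<longrightarrow>
         Lbound S g m \<omega> \<le> pbar S g (Ncount S g m \<omega>) \<omega>)} = certified"
    by (auto simp: certified_def active_def)
  finally show ?thesis .
qed

text \<open>\<open>Lbound\<close> is truncated at 0, so certification also requires
  \<open>pbar\<close> to be non-negative, and conditional probabilities are so only almost surely.
  One null set serves both groups and all samples.\<close>

lemma AE_pcond_nonneg: "AE \<omega> in PM S. \<forall>g i. 0 \<le> pcond S g (Suc i) \<omega>"
proof -
  have "AE \<omega> in PM S. \<forall>i. 0 \<le> pcond S g (Suc i) \<omega>" for g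
    unfolding AE_all_countable pcond_eq
  proof
    fix i
    have "success g i \<in> sets (PM S)"
      using success_in_Gfilt[of g i] subalgebra_Gfilt[of g "Suc i"] by (auto simp: subalgebra_def)
    then show "AE \<omega> in PM S. 0 \<le> real_cond_exp (PM S) (Gfilt S g i) (indicator (success g i)) \<omega>"
      using PM.real_cond_exp_indicator_bounds[OF subalgebra_Gfilt] by fastforce
  qed
  from this[of Aggregate] this[of Core] show ?thesis
    by eventually_elim (metis group.exhaust)
qed

text \<open>The two arguments of the maximum in \<open>Lbound\<close> are treated apart: 0 by
  non-negativity, the other by absence of deviation at
  \<open>q = Ncount S g m \<omega>\<close>.\<close>

lemma certified_if_no_deviation:
  assumes \<omega>: "\<omega> \<in> selected S" and nonneg: "\<And>g i. 0 \<le> pcond S g (Suc i) \<omega>"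
    and dev: "\<And>g. \<omega> \<in> active S g \<Longrightarrow> \<omega> \<notin> deviation g"
  shows "\<omega> \<in> certified"
proof -
  have "Lbound S g m \<omega> \<le> pbar S g (Ncount S g m \<omega>) \<omega>"
    if g: "enabled S g \<omega>" and q: "0 < Ncount S g m \<omega>" for g m
  proof -
    have "0 \<le> pbar S g (Ncount S g m \<omega>) \<omega>"
      unfolding pbar_def by (auto intro!: divide_nonneg_nonneg sum_nonneg nonneg simp: sum.atLeast1_atMost_eq)
    moreover have "\<omega> \<notin> deviation g" using dev[of g] g \<omega> by (simp add: active_def)
    then have "\<not> pbar S g (Ncount S g m \<omega>) \<omega> < phat S g (Ncount S g m \<omega>) \<omega>
        - sqrt (ln (1 / dlevq S g (Ncount S g m \<omega>) \<omega>) / (2 * real (Ncount S g m \<omega>)))"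
      using \<omega> q unfolding deviation_def by blast
    ultimately show ?thesis using q by (simp add: Lbound_def Let_def)
  qed
  then show ?thesis using \<omega> by (simp add: certified_def)
qed

text \<open>Up to a null set, failure on \<open>A\<close> lies in the union of the two deviation
  events. Subadditivity covers any dependence between them, and the two levels add up to at most
  \<open>delta S\<close> pointwise under the integral.\<close>

lemma emeasure_uncertified_le:
  assumes A: "A \<in> sets (sel_info S)" "A \<subseteq> selected S"
  shows "emeasure (PM S) (A - certified) \<le> (\<integral>\<^sup>+\<omega>\<in>A. ennreal (delta S \<omega>) \<partial>PM S)"
proof -
  let ?D = "\<lambda>g. A \<inter> active S g \<inter> deviation g"
  let ?f = "\<lambda>g \<omega>. ennreal (dlev S g \<omega>) * indicator (A \<inter> active S g) \<omega>"
  have AM: "A \<in> sets (PM S)" using A sets_sel_info_subset by auto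
  have dev: "?D g \<in> sets (PM S)" for g
  proof -
    note [measurable] = phat_meas pbar_meas radius_meas
    have "deviation g \<in> sets (PM S)"
      unfolding deviation_def
      by (rule sets_Collect_restrict_space[OF sets_selected]) measurable
    then show ?thesis by (intro sets.Int AM sets_active)
  qed
  \<comment> \<open>\<open>dlev\<close> is measurable on \<open>selected S\<close> only; extending
    it by 0 leaves the product unchanged because \<open>A\<close> lies in
    \<open>selected S\<close>.\<close>
  have f: "?f g \<in> borel_measurable (PM S)" for g
  proof -
    have "(\<lambda>\<omega>. if \<omega> \<in> selected S then dlev S g \<omega> else 0) \<in> borel_measurable (PM S)"
      using sets_selected dlev_meas_sel
      by (intro measurable_If_restrict_space_iff[THEN iffD2]) auto
    then have "(\<lambda>\<omega>. ennreal (if \<omega> \<in> selected S then dlev S g \<omega> else 0) * indicator (A \<inter> active S g) \<omega>)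
        \<in> borel_measurable (PM S)"
      using AM sets_active[of g] by measurable
    then show ?thesis
      by (rule measurable_cong[THEN iffD1, rotated]) (use A in \<open>auto simp: indicator_def\<close>)
  qed
  have "emeasure (PM S) (A - certified) \<le> emeasure (PM S) (?D Aggregate \<union> ?D Core)"
  proof (rule emeasure_mono_AE)
    show "AE \<omega> in PM S. \<omega> \<in> A - certified \<longrightarrow> \<omega> \<in> ?D Aggregate \<union> ?D Core"
      using AE_pcond_nonneg
    proof eventually_elim
      case (elim \<omega>)
      show ?case
      proof
        assume \<omega>: "\<omega> \<in> A - certified"
        then obtain g where "\<omega> \<in> active S g" "\<omega> \<in> deviation g"
          using certified_if_no_deviation[of \<omega>] A(2) elim by blast
        then show "\<omega> \<in> ?D Aggregate \<union> ?D Core" using \<omega> by (cases g) auto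
      qed
    qed
  qed (intro sets.Un dev)
  also have "\<dots> \<le> emeasure (PM S) (?D Aggregate) + emeasure (PM S) (?D Core)"
    by (rule emeasure_subadditive) (rule dev)+
  also have "\<dots> \<le> (\<integral>\<^sup>+\<omega>. ?f Aggregate \<omega> \<partial>PM S) + (\<integral>\<^sup>+\<omega>. ?f Core \<omega> \<partial>PM S)"
    by (intro add_mono emeasure_deviation_le A)
  also have "\<dots> = (\<integral>\<^sup>+\<omega>. ?f Aggregate \<omega> + ?f Core \<omega> \<partial>PM S)"
    by (intro nn_integral_add[symmetric] f)
  also have "\<dots> \<le> (\<integral>\<^sup>+\<omega>\<in>A. ennreal (delta S \<omega>) \<partial>PM S)"
  proof (rule nn_integral_mono)
    fix \<omega>
    show "?f Aggregate \<omega> + ?f Core \<omega> \<le> ennreal (delta S \<omega>) * indicator A \<omega>"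
    proof (cases "\<omega> \<in> A")
      case True
      then have \<omega>: "\<omega> \<in> selected S" using A by auto
      have nonneg: "0 \<le> dlev S Aggregate \<omega>" "0 \<le> dlev S Core \<omega>"
        using dlev_all[OF \<omega>] dlev_core[OF \<omega>] by (auto split: if_splits)
      have "?f Aggregate \<omega> + ?f Core \<omega> \<le> ennreal (dlev S Aggregate \<omega>) + ennreal (dlev S Core \<omega>)"
        by (intro add_mono) (auto simp: indicator_def)
      also have "\<dots> = ennreal (dlev S Aggregate \<omega> + dlev S Core \<omega>)"
        using nonneg by simp
      also have "\<dots> \<le> ennreal (delta S \<omega>)" by (rule ennreal_leI[OF dlev_sum[OF \<omega>]])
      finally show ?thesis using True by simp
    qed simp
  qed
  finally show ?thesis .
qed

end

theorem proposition3:
  fixes S :: "('w, 'ap::finite, 'x) setting"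
  assumes "certification_setting S"
  shows "AE \<omega> in PM S. nstar S \<omega> < \<infinity> \<longrightarrow>
           real_cond_exp (PM S) (sel_info S)
             (indicator {\<omega> \<in> selected S.
                \<forall>g. enabled S g \<omega> \<longrightarrow>
                  (\<forall>m. nstar S \<omega> < enat m \<and> 0 < Ncount S g m \<omega> \<longrightarrow>
                     pbar S g (Ncount S g m \<omega>) \<omega> \<ge> Lbound S g m \<omega>)}) \<omega>
           \<ge> 1 - delta S \<omega>"
proof -
  interpret certification_setting S by fact
  \<comment> \<open>Here \<open>D\<close> is the selection event and \<open>c\<close> the total
    level; the integrated hypothesis is \<open>emeasure_uncertified_le\<close>.\<close>
  have "AE \<omega> in PM S. \<omega> \<in> selected S \<longrightarrow>
      1 - delta S \<omega> \<le> real_cond_exp (PM S) (sel_info S) (indicator certified) \<omega>"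
    by (rule PM.real_cond_exp_indicator_ge[OF subalgebra_sel_info sets_certified
          selected_in_sel_info delta_meas])
       (use delta_range in \<open>auto intro: less_imp_le emeasure_uncertified_le\<close>)
  then show ?thesis
    using AE_space unfolding certified_def by eventually_elim (auto simp: selected_def)
qed

end
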